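(* Let $M$ be an $\mathbb{O}$-bimodule which, as a left $\mathbb{O}$-module, is of type $(\mu,\nu)$. Then $\nu=0$.
   Context: $\mathbb{O}$ denotes the real $8$-dimensional division algebra of octonions. A left $\mathbb{O}$-module is a real vector space $M$ with an $\mathbb{R}$-bilinear map $\mathbb{O}\times M\to M$, $(q,m)\mapsto qm$, such that $1m=m$ and $[p,q,m]=-[q,p,m]$ for all $p,q\in\mathbb{O}$, $m\in M$, where $[p,q,m]:=(pq)m-p(qm)$. Right $\mathbb{O}$-modules are defined symmetrically: an $\mathbb{R}$-bilinear action $(m,q)\mapsto mq$ with $m1=m$ and $[m,p,q]=-[m,q,p]$, where $[m,p,q]:=(mp)q-m(pq)$. An $\mathbb{O}$-bimodule is a real vector space $M$ that is both a left and a right $\mathbb{O}$-module such that $[p,q,m]=[q,m,p]=[m,p,q]$ for all $p,q\in\mathbb{O}$, $m\in M$, where $[q,m,p]:=(qm)p-q(mp)$. For a left $\mathbb{O}$-module $M$, $\mathcal{A}(M):=\{m\in M\mid (pq)m-p(qm)=0\ \forall p,q\in\mathbb{O}\}$ and $\mathcal{A}^{-}(M):=\{m\in M\mid (pq)m-q(pm)=0\ \forall p,q\in\mathbb{O}\}$. The type of $M$ is the pair $(\dim_{\mathbb{R}}\mathcal{A}(M),\dim_{\mathbb{R}}\mathcal{A}^{-}(M))$. *)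

theory Defs
  imports "HOL-Analysis.Analysis"
begin

unbundle cardinal_syntax

no_notation elt_set_eq (infix \<open>=o\<close> 50)

section \<open>Octonions\<close>

text \<open>
  The product is neither associative nor commutative, so the octonions belong to none of the
  library's classes of rings or algebras, only to \<^class>\<open>real_vector\<close>, \<^class>\<open>times\<close>
  and \<^class>\<open>one\<close>.
\<close>

datatype octonion = Octonion
  (Ree: real) (Im1: real) (Im2: real) (Im3: real)
  (Im4: real) (Im5: real) (Im6: real) (Im7: real)

lemma octonion_eq_iff:
  "x = y \<longleftrightarrow> Ree x = Ree y \<and> Im1 x = Im1 y \<and> Im2 x = Im2 y \<and> Im3 x = Im3 y \<and>
     Im4 x = Im4 y \<and> Im5 x = Im5 y \<and> Im6 x = Im6 y \<and> Im7 x = Im7 y"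
  by (cases x; cases y) simp

instantiation octonion :: real_vector
begin

definition zero_octonion :: octonion where
  "0 = Octonion 0 0 0 0 0 0 0 0"

definition plus_octonion :: "octonion \<Rightarrow> octonion \<Rightarrow> octonion" where
  "x + y = Octonion (Ree x + Ree y) (Im1 x + Im1 y) (Im2 x + Im2 y) (Im3 x + Im3 y)
    (Im4 x + Im4 y) (Im5 x + Im5 y) (Im6 x + Im6 y) (Im7 x + Im7 y)"

definition uminus_octonion :: "octonion \<Rightarrow> octonion" where
  "- x = Octonion (- Ree x) (- Im1 x) (- Im2 x) (- Im3 x)
    (- Im4 x) (- Im5 x) (- Im6 x) (- Im7 x)"

definition minus_octonion :: "octonion \<Rightarrow> octonion \<Rightarrow> octonion" where
  "x - y = Octonion (Ree x - Ree y) (Im1 x - Im1 y) (Im2 x - Im2 y) (Im3 x - Im3 y)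
    (Im4 x - Im4 y) (Im5 x - Im5 y) (Im6 x - Im6 y) (Im7 x - Im7 y)"

definition scaleR_octonion :: "real \<Rightarrow> octonion \<Rightarrow> octonion" where
  "r *\<^sub>R x = Octonion (r * Ree x) (r * Im1 x) (r * Im2 x) (r * Im3 x)
    (r * Im4 x) (r * Im5 x) (r * Im6 x) (r * Im7 x)"

instance
  by standard
    (simp_all add: octonion_eq_iff zero_octonion_def plus_octonion_def uminus_octonion_def
      minus_octonion_def scaleR_octonion_def algebra_simps)

end

text \<open>
  With the basis \<open>e\<^sub>0 = 1, e\<^sub>1, \<dots>, e\<^sub>7\<close>, where \<open>e\<^sub>i\<^sup>2 = -1\<close> for \<open>i \<ge> 1\<close>, the product is given by
  \<open>e\<^sub>i e\<^sub>j = e\<^sub>k = - e\<^sub>j e\<^sub>i\<close> for all cyclic permutations \<open>(i, j, k)\<close> of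
  \<open>123, 145, 176, 246, 257, 347, 365\<close>.
\<close>

instantiation octonion :: "{one, times}"
begin

definition one_octonion :: octonion where
  "1 = Octonion 1 0 0 0 0 0 0 0"

definition times_octonion :: "octonion \<Rightarrow> octonion \<Rightarrow> octonion" where
  "x * y = Octonion
    (Ree x * Ree y - Im1 x * Im1 y - Im2 x * Im2 y - Im3 x * Im3 y
      - Im4 x * Im4 y - Im5 x * Im5 y - Im6 x * Im6 y - Im7 x * Im7 y)
    (Ree x * Im1 y + Im1 x * Ree y + Im2 x * Im3 y - Im3 x * Im2 y
      + Im4 x * Im5 y - Im5 x * Im4 y - Im6 x * Im7 y + Im7 x * Im6 y)
    (Ree x * Im2 y - Im1 x * Im3 y + Im2 x * Ree y + Im3 x * Im1 y
      + Im4 x * Im6 y + Im5 x * Im7 y - Im6 x * Im4 y - Im7 x * Im5 y)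
    (Ree x * Im3 y + Im1 x * Im2 y - Im2 x * Im1 y + Im3 x * Ree y
      + Im4 x * Im7 y - Im5 x * Im6 y + Im6 x * Im5 y - Im7 x * Im4 y)
    (Ree x * Im4 y - Im1 x * Im5 y - Im2 x * Im6 y - Im3 x * Im7 y
      + Im4 x * Ree y + Im5 x * Im1 y + Im6 x * Im2 y + Im7 x * Im3 y)
    (Ree x * Im5 y + Im1 x * Im4 y - Im2 x * Im7 y + Im3 x * Im6 y
      - Im4 x * Im1 y + Im5 x * Ree y - Im6 x * Im3 y + Im7 x * Im2 y)
    (Ree x * Im6 y + Im1 x * Im7 y + Im2 x * Im4 y - Im3 x * Im5 y
      - Im4 x * Im2 y + Im5 x * Im3 y + Im6 x * Ree y - Im7 x * Im1 y)
    (Ree x * Im7 y - Im1 x * Im6 y + Im2 x * Im5 y + Im3 x * Im4 y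
      - Im4 x * Im3 y - Im5 x * Im2 y + Im6 x * Im1 y + Im7 x * Ree y)"

instance ..

end

lemma octonion_sel [simp]:
  "Ree 0 = 0" "Im1 0 = 0"
  "Im2 0 = 0" "Im3 0 = 0"
  "Im4 0 = 0" "Im5 0 = 0"
  "Im6 0 = 0" "Im7 0 = 0"
  "Ree 1 = 1" "Im1 1 = 0"
  "Im2 1 = 0" "Im3 1 = 0"
  "Im4 1 = 0" "Im5 1 = 0"
  "Im6 1 = 0" "Im7 1 = 0"
  "Ree (x + y) = Ree x + Ree y" "Im1 (x + y) = Im1 x + Im1 y"
  "Im2 (x + y) = Im2 x + Im2 y" "Im3 (x + y) = Im3 x + Im3 y"
  "Im4 (x + y) = Im4 x + Im4 y" "Im5 (x + y) = Im5 x + Im5 y"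
  "Im6 (x + y) = Im6 x + Im6 y" "Im7 (x + y) = Im7 x + Im7 y"
  "Ree (- x) = - Ree x" "Im1 (- x) = - Im1 x"
  "Im2 (- x) = - Im2 x" "Im3 (- x) = - Im3 x"
  "Im4 (- x) = - Im4 x" "Im5 (- x) = - Im5 x"
  "Im6 (- x) = - Im6 x" "Im7 (- x) = - Im7 x"
  "Ree (x - y) = Ree x - Ree y" "Im1 (x - y) = Im1 x - Im1 y"
  "Im2 (x - y) = Im2 x - Im2 y" "Im3 (x - y) = Im3 x - Im3 y"
  "Im4 (x - y) = Im4 x - Im4 y" "Im5 (x - y) = Im5 x - Im5 y"
  "Im6 (x - y) = Im6 x - Im6 y" "Im7 (x - y) = Im7 x - Im7 y"
  "Ree (r *\<^sub>R x) = r * Ree x" "Im1 (r *\<^sub>R x) = r * Im1 x"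
  "Im2 (r *\<^sub>R x) = r * Im2 x" "Im3 (r *\<^sub>R x) = r * Im3 x"
  "Im4 (r *\<^sub>R x) = r * Im4 x" "Im5 (r *\<^sub>R x) = r * Im5 x"
  "Im6 (r *\<^sub>R x) = r * Im6 x" "Im7 (r *\<^sub>R x) = r * Im7 x"
  by (simp_all add: zero_octonion_def one_octonion_def plus_octonion_def uminus_octonion_def
      minus_octonion_def scaleR_octonion_def)

text \<open>
  The octonions are, up to isomorphism, the only alternative real division algebra of dimension
  eight; the next lemmas confirm that the table above gives that algebra.
\<close>

lemma bilinear_times_octonion: "bilinear ((*) :: octonion \<Rightarrow> octonion \<Rightarrow> octonion)"
  by (simp add: bilinear_def linear_iff octonion_eq_iff times_octonion_def algebra_simps)

lemma octonion_mult_1 [simp]: "1 * x = x" "x * 1 = x" for x :: octonion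
  by (simp_all add: octonion_eq_iff times_octonion_def)

lemma octonion_left_alternative: "(x * x) * y = x * (x * y)" for x y :: octonion
  by (simp add: octonion_eq_iff times_octonion_def algebra_simps)

lemma octonion_right_alternative: "(x * y) * y = x * (y * y)" for x y :: octonion
  by (simp add: octonion_eq_iff times_octonion_def algebra_simps)

definition octonion_norm_sq :: "octonion \<Rightarrow> real" where
  "octonion_norm_sq x = (Ree x)\<^sup>2 + (Im1 x)\<^sup>2 + (Im2 x)\<^sup>2 + (Im3 x)\<^sup>2 +
     (Im4 x)\<^sup>2 + (Im5 x)\<^sup>2 + (Im6 x)\<^sup>2 + (Im7 x)\<^sup>2"

lemma octonion_norm_sq_mult:
  "octonion_norm_sq (x * y) = octonion_norm_sq x * octonion_norm_sq y"
  by (simp add: octonion_norm_sq_def times_octonion_def power2_eq_square algebra_simps)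

lemma octonion_norm_sq_eq_0_iff: "octonion_norm_sq x = 0 \<longleftrightarrow> x = 0"
  by (simp add: octonion_norm_sq_def octonion_eq_iff add_nonneg_eq_0_iff)

lemma octonion_mult_eq_0_iff: "x * y = 0 \<longleftrightarrow> x = 0 \<or> y = 0" for x y :: octonion
  by (simp flip: octonion_norm_sq_eq_0_iff add: octonion_norm_sq_mult)

section \<open>Octonionic modules\<close>

locale left_octonion_module =
  fixes lact :: "octonion \<Rightarrow> 'm::real_vector \<Rightarrow> 'm"
  assumes bilinear_lact: "bilinear lact"
    and lact_one: "lact 1 m = m"
    and lact_alternative:
      "lact (p * q) m - lact p (lact q m) = - (lact (q * p) m - lact q (lact p m))"

locale right_octonion_module =
  fixes ract :: "'m::real_vector \<Rightarrow> octonion \<Rightarrow> 'm"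
  assumes bilinear_ract: "bilinear ract"
    and ract_one: "ract m 1 = m"
    and ract_alternative:
      "ract (ract m p) q - ract m (p * q) = - (ract (ract m q) p - ract m (q * p))"

locale octonion_bimodule = left_octonion_module lact + right_octonion_module ract
  for lact :: "octonion \<Rightarrow> 'm::real_vector \<Rightarrow> 'm" and ract :: "'m \<Rightarrow> octonion \<Rightarrow> 'm" +
  assumes left_eq_middle_associator:
      "lact (p * q) m - lact p (lact q m) = ract (lact q m) p - lact q (ract m p)"
    and middle_eq_right_associator:
      "ract (lact q m) p - lact q (ract m p) = ract (ract m p) q - ract m (p * q)"

section \<open>The type of a left module\<close>

definition associative_elements :: "(octonion \<Rightarrow> 'm::real_vector \<Rightarrow> 'm) \<Rightarrow> 'm set" where
  "associative_elements lact = {m. \<forall>p q. lact (p * q) m - lact p (lact q m) = 0}"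

definition conj_associative_elements :: "(octonion \<Rightarrow> 'm::real_vector \<Rightarrow> 'm) \<Rightarrow> 'm set" where
  "conj_associative_elements lact = {m. \<forall>p q. lact (p * q) m - lact q (lact p m) = 0}"

text \<open>
  Modules may be infinite-dimensional, where \<^const>\<open>dim\<close> has the value \<open>0\<close>. Dimensions are therefore
  cardinals, up to \<open>=o\<close>.
\<close>

definition has_real_dimension :: "'m::real_vector set \<Rightarrow> 'k rel \<Rightarrow> bool" where
  "has_real_dimension V \<kappa> \<longleftrightarrow> (\<exists>B. independent B \<and> span B = V \<and> |B| =o \<kappa>)"

lemma has_real_dimension_exists:
  fixes V :: "'m::real_vector set"
  assumes "subspace V"
  shows "\<exists>B :: 'm set. has_real_dimension V |B|"
proof -
  obtain B where B: "B \<subseteq> V" "independent B" "V \<subseteq> span B"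
    by (rule real_vector.basis_exists[of V])
  then have "span B = V"
    using assms by (simp add: span_minimal subset_antisym)
  then have "has_real_dimension V |B|"
    unfolding has_real_dimension_def using B(2) by (intro exI[of _ B] conjI card_of_refl)
  then show ?thesis
    by (rule exI)
qed

lemma has_real_dimension_unique:
  assumes "has_real_dimension V \<kappa>" "has_real_dimension V \<kappa>'"
  shows "\<kappa> =o \<kappa>'"
proof -
  from assms(1) obtain B where B: "independent B" "span B = V" "|B| =o \<kappa>"
    unfolding has_real_dimension_def by (elim exE conjE)
  from assms(2) obtain C where C: "independent C" "span C = V" "|C| =o \<kappa>'"
    unfolding has_real_dimension_def by (elim exE conjE)
  have "\<exists>f. bij_betw f B C"
    using B(1,2) C(1,2) by (intro real_vector.bij_if_span_eq_span_bases) simp_all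
  then have "|B| =o |C|"
    by (simp add: card_of_ordIso)
  then show ?thesis
    by (rule ordIso_transitive[OF ordIso_symmetric[OF B(3)] ordIso_transitive[OF _ C(3)]])
qed

definition octonion_module_type ::
    "(octonion \<Rightarrow> 'm::real_vector \<Rightarrow> 'm) \<Rightarrow> 'k rel \<times> 'l rel \<Rightarrow> bool" where
  "octonion_module_type lact = (\<lambda>(\<mu>, \<nu>).
     has_real_dimension (associative_elements lact) \<mu> \<and>
     has_real_dimension (conj_associative_elements lact) \<nu>)"

lemma (in left_octonion_module) subspace_associative_elements:
  "subspace (associative_elements lact)"
  using bilinear_lact
  by (auto simp: subspace_def associative_elements_def bilinear_radd bilinear_rmul bilinear_rzero)

lemma (in left_octonion_module) subspace_conj_associative_elements:
  "subspace (conj_associative_elements lact)"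
  using bilinear_lact
  by (auto simp: subspace_def conj_associative_elements_def
      bilinear_radd bilinear_rmul bilinear_rzero)

end

theory Submission
  imports Defs
begin

text \<open>
  Write \<open>[p, q, m]\<close>, \<open>[q, m, p]\<close> and \<open>[m, p, q]\<close> for the three associators, which agree in a
  bimodule. The claim is that an element \<open>m\<close> with \<open>(pq)m = q(pm)\<close> for all \<open>p, q\<close> vanishes. For such
  an \<open>m\<close> the associator \<open>[p, q, m] = (pq - qp)m\<close> is expressed by the left action alone.

  The right action on the elements \<open>qm\<close> is then forced as well. If \<open>p\<^sup>2 = -1\<close> and \<open>p\<close> anticommutes with \<open>q\<close>,
  every right module satisfies \<open>[m, p, pq] = [m, p, q]p\<close>
  (\<open>right_associator_mult_unit\<close>), an instance of the identity \<open>(x, xy, z) = (x, y, z)x\<close>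
  of alternative algebras; replacing both associators by commutators yields
  \<open>(qm)p = (pq)m\<close> (\<open>right_action_on_conj_associative\<close>).

  Evaluate now \<open>[p, r, n] = [r, n, p]\<close> at \<open>n = qm\<close>, where \<open>p, q, r\<close> are three of the
  basis units that lie in no common quaternion subalgebra. Reordering the factors, the left side becomes
  \<open>(q(pr) - (qr)p)m\<close>, which is \<open>0\<close> by alternativity because \<open>p\<close>, \<open>q\<close>, \<open>r\<close> anticommute pairwise
  and \<open>q\<close> anticommutes with \<open>pr\<close>; the right side becomes \<open>(p(qr) - (pq)r)m\<close>, where the octonion in front of \<open>m\<close> is, up to
  sign, the associator of \<open>p, q, r\<close> and does not vanish. Since the octonions have inverses, \<open>m = 0\<close>.
\<close>

lemma octonion_mult_minus [simp]: "- a * b = - (a * b)" "a * - b = - (a * b)" for a b :: octonion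
  by (simp_all add: bilinear_lneg bilinear_rneg bilinear_times_octonion)

lemma octonion_anticommuting_unit_absorb:
  fixes p q :: octonion
  assumes unit: "p * p = - 1" and anticomm: "q * p = - (p * q)"
  shows "p * (p * q) = - q" and "(p * q) * p = q"
proof -
  show "p * (p * q) = - q"
    using octonion_left_alternative[of p q] by (simp add: unit)
  show "(p * q) * p = q"
    using octonion_right_alternative[of q p] by (simp add: unit anticomm)
qed

text \<open>
  The factors \<open>(mp)p = -m\<close>, \<open>p(pq) = -q\<close> and \<open>(pq)p = q\<close> collapse, so that right alternativity at
  \<open>mp, p, q\<close> gives \<open>((mp)q)p = mq\<close>, and at \<open>m, p, pq\<close> it gives the rest.
\<close>

lemma (in right_octonion_module) right_associator_mult_unit:
  assumes unit: "p * p = - 1" and anticomm: "q * p = - (p * q)"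
  shows "ract (ract m p) (p * q) - ract m (p * (p * q)) = ract (ract (ract m p) q - ract m (p * q)) p"
proof -
  note [simp] = bilinear_lneg[OF bilinear_ract] bilinear_rneg[OF bilinear_ract]
    bilinear_lsub[OF bilinear_ract] ract_one
  have ppq: "p * (p * q) = - q" and pqp: "(p * q) * p = q"
    using octonion_anticommuting_unit_absorb[OF unit anticomm] .
  have mpp: "ract (ract m p) p = - m"
  proof -
    have "2 *\<^sub>R (ract (ract m p) p - ract m (p * p)) = 0"
      unfolding scaleR_2 using ract_alternative[of m p p] by (metis add.left_inverse)
    then show ?thesis
      by (simp add: unit add_eq_0_iff2)
  qed
  have "ract (ract (ract m p) q) p = ract m q"
    using ract_alternative[of "ract m p" p q] by (simp add: mpp anticomm)
  moreover have "ract (ract m p) (p * q) + ract m q = ract m q - ract (ract m (p * q)) p"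
    using ract_alternative[of m p "p * q"] by (simp add: ppq pqp)
  ultimately show ?thesis
    by (simp add: ppq)
qed

lemma (in left_octonion_module) associator_conj_associative:
  assumes "m \<in> conj_associative_elements lact"
  shows "lact (p * q) m - lact p (lact q m) = lact (p * q - q * p) m"
  using assms by (simp add: conj_associative_elements_def bilinear_lsub[OF bilinear_lact])

text \<open>
  The preceding identities are used at \<open>m, p, pq\<close>: there \<open>[m, p, pq]\<close> is \<open>-2(qm)\<close>, and
  \<open>[m, p, p(pq)] = -[m, p, q]\<close> is \<open>-2((pq)m)\<close>.
\<close>

lemma (in octonion_bimodule) right_action_on_conj_associative:
  assumes m: "m \<in> conj_associative_elements lact"
    and unit: "p * p = - 1" and anticomm: "q * p = - (p * q)"
  shows "ract (lact q m) p = lact (p * q) m"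
proof -
  have right_associator: "ract (ract m a) b - ract m (a * b) = lact (a * b - b * a) m" for a b
    using left_eq_middle_associator[of a b m] middle_eq_right_associator[of b m a]
      associator_conj_associative[OF m, of a b] by simp
  have ppq: "p * (p * q) = - q" and pqp: "(p * q) * p = q"
    using octonion_anticommuting_unit_absorb[OF unit anticomm] .
  have "(p * q) * p = - (p * (p * q))"
    by (simp add: ppq pqp)
  from right_associator_mult_unit[OF unit this, of m]
  have "lact (p * (p * (p * q)) - (p * (p * q)) * p) m = ract (lact (p * (p * q) - (p * q) * p) m) p"
    by (simp only: right_associator)
  moreover have "p * (p * (p * q)) - (p * (p * q)) * p = (- 2) *\<^sub>R (p * q)"
    by (simp add: ppq anticomm scaleR_2)
  moreover have "p * (p * q) - (p * q) * p = (- 2) *\<^sub>R q"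
    by (simp add: ppq pqp scaleR_2)
  ultimately show ?thesis
    by (simp add: bilinear_lmul[OF bilinear_lact] bilinear_lmul[OF bilinear_ract]
        del: scaleR_minus_left)
qed

theorem (in octonion_bimodule) conj_associative_elements_eq_0:
  "conj_associative_elements lact = {0}"
proof -
  have "m = 0" if m: "m \<in> conj_associative_elements lact" for m
  proof -
    \<comment> \<open>The units are \<open>e\<^sub>1, e\<^sub>4, e\<^sub>2\<close>, and \<open>s\<close> is the inverse of \<open>p(qr) - (pq)r = 2e\<^sub>7\<close>.\<close>
    define p q r s where
      "p = Octonion 0 1 0 0 0 0 0 0" and "q = Octonion 0 0 0 0 1 0 0 0" and
      "r = Octonion 0 0 1 0 0 0 0 0" and "s = Octonion 0 0 0 0 0 0 0 (- 1 / 2)"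
    note units = p_def q_def r_def s_def octonion_eq_iff times_octonion_def
    have conj: "lact a (lact b m) = lact (b * a) m" for a b
      using m by (simp add: conj_associative_elements_def)
    have "lact (p * r) (lact q m) - lact p (lact r (lact q m)) = lact (q * (p * r) - (q * r) * p) m"
      by (simp add: conj bilinear_lsub[OF bilinear_lact])
    moreover have "q * (p * r) - (q * r) * p = 0"
      by (simp add: units)
    moreover have "ract (lact r (lact q m)) p = lact (p * (q * r)) m"
      unfolding conj by (rule right_action_on_conj_associative[OF m]) (simp_all add: units)
    moreover have "ract (lact q m) p = lact (p * q) m"
      by (rule right_action_on_conj_associative[OF m]) (simp_all add: units)
    ultimately have "lact (p * (q * r) - (p * q) * r) m = 0"
      using left_eq_middle_associator[of p r "lact q m"]
      by (simp add: conj bilinear_lsub[OF bilinear_lact] bilinear_lzero[OF bilinear_lact])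
    then have "lact ((p * (q * r) - (p * q) * r) * s) m = 0"
      by (simp flip: conj add: bilinear_rzero[OF bilinear_lact])
    moreover have "(p * (q * r) - (p * q) * r) * s = 1"
      by (simp add: units)
    ultimately show "m = 0"
      by (simp add: lact_one)
  qed
  then show ?thesis
    using subspace_0[OF subspace_conj_associative_elements] by auto
qed

theorem theorem4p8:
  fixes lact :: "octonion \<Rightarrow> 'm::real_vector \<Rightarrow> 'm"
    and ract :: "'m \<Rightarrow> octonion \<Rightarrow> 'm"
    and \<mu> :: "'k rel" and \<nu> :: "'l rel"
  assumes "octonion_bimodule lact ract"
    and "octonion_module_type lact (\<mu>, \<nu>)"
  shows "\<nu> =o (czero :: 'l rel)"
proof -
  obtain B :: "'m set" where B: "independent B" "span B = {0}" "|B| =o \<nu>"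
    using assms(2) octonion_bimodule.conj_associative_elements_eq_0[OF assms(1)]
    by (auto simp: octonion_module_type_def has_real_dimension_def)
  have "B = {}"
    using B(1,2) span_superset[of B] dependent_zero[of B] by auto
  then have "|B| =o (czero :: 'l rel)"
    by (simp add: czero_def card_of_empty_ordIso)
  then show ?thesis
    by (rule ordIso_transitive[OF ordIso_symmetric[OF B(3)]])
qed

end
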